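(* Let $M$ be a set which contains an infinite, not constant, arithmetic (respectively geometric) progression. Then, whatever the way in which $M$ is partitioned into two subsets, at least one of these subsets contains at least three terms in arithmetic (respectively geometric) progression.
   Context: An infinite arithmetic progression of ratio $r$ is a sequence $a_1, a_2, \dots$ with $a_n = a_1 + (n-1)r$ for $n \ge 1$; an infinite geometric progression of ratio $r$ is a sequence $a_1, a_2, \dots$ with $a_n = a_1 r^{n-1}$ for $n \ge 1$. A set contains such a progression if all of its terms belong to the set. Three terms $x,y,z$ are in arithmetic progression if $2y = x+z$, and in geometric progression if $y^2 = xz$. The statement comprises two assertions, one for arithmetic and one for geometric progressions.
   Formalization: In the geometric case three distinct elements are claimed only if the progression has infinitely many values (ratio -1 or 0 are counterexamples: {1},{-1}); otherwise only three terms at distinct positions with y^2 = xz. Sets lie in a field of characteristic 0. *)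

theory Defs
  imports Complex_Main
begin

text \<open>
  Progressions are sequences indexed from 0, so the \<open>n\<close>-th term in 1-based numbering is \<open>a (n - 1)\<close>.
\<close>

definition arith_progression :: "(nat \<Rightarrow> 'a::field_char_0) \<Rightarrow> 'a \<Rightarrow> bool" where
  "arith_progression a r \<longleftrightarrow> (\<forall>n. a n = a 0 + of_nat n * r)"

definition geom_progression :: "(nat \<Rightarrow> 'a::field_char_0) \<Rightarrow> 'a \<Rightarrow> bool" where
  "geom_progression a r \<longleftrightarrow> (\<forall>n. a n = a 0 * r ^ n)"

definition nonconstant :: "(nat \<Rightarrow> 'a) \<Rightarrow> bool" where
  "nonconstant a \<longleftrightarrow> (\<exists>m n. a m \<noteq> a n)"

definition in_arith :: "'a::field_char_0 \<Rightarrow> 'a \<Rightarrow> 'a \<Rightarrow> bool" where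
  "in_arith x y z \<longleftrightarrow> 2 * y = x + z"

definition in_geom :: "'a::field_char_0 \<Rightarrow> 'a \<Rightarrow> 'a \<Rightarrow> bool" where
  "in_geom x y z \<longleftrightarrow> y ^ 2 = x * z"

text \<open>
  The elements are required to be distinct, since \<open>x, x, x\<close> trivially satisfies both relations.
\<close>

definition contains_three_arith :: "'a::field_char_0 set \<Rightarrow> bool" where
  "contains_three_arith X \<longleftrightarrow> (\<exists>x\<in>X. \<exists>y\<in>X. \<exists>z\<in>X. distinct [x, y, z] \<and> in_arith x y z)"

definition contains_three_geom :: "'a::field_char_0 set \<Rightarrow> bool" where
  "contains_three_geom X \<longleftrightarrow> (\<exists>x\<in>X. \<exists>y\<in>X. \<exists>z\<in>X. distinct [x, y, z] \<and> in_geom x y z)"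

text \<open>
  A nonconstant geometric progression may have only finitely many values, namely when its ratio is
  0 or a root of unity other than 1. For ratio \<open>-1\<close> or 0 there are just two values, and no three
  distinct elements can be demanded. The following notion makes sense for all ratios: three terms
  of the sequence \<open>a\<close> with distinct indices, whose values lie in \<open>X\<close>. It amounts to distinctness
  of the values whenever \<open>a\<close> is injective.
\<close>

definition contains_three_geom_terms :: "(nat \<Rightarrow> 'a::field_char_0) \<Rightarrow> 'a set \<Rightarrow> bool" where
  "contains_three_geom_terms a X \<longleftrightarrow>
    (\<exists>i j k. distinct [i, j, k] \<and> a i \<in> X \<and> a j \<in> X \<and> a k \<in> X \<and> in_geom (a i) (a j) (a k))"

end

theory Submission imports Defs begin

text \<open>
  The theorem is the van der Waerden bound \<open>W(3; 2) \<le> 9\<close> applied to the first nine indices of the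
  progression: equidistant indices give terms in progression. Such terms are distinct when the
  progression is injective; a noninjective geometric progression is eventually periodic, so its
  range is finite.
\<close>

text \<open>Nine indices suffice, which leaves a finite propositional check in \<open>P 0\<close>,
  ..., \<open>P 8\<close>. Eight would not: the colouring 11001100 of \<open>0..7\<close> has no
  monochromatic triple.\<close>

lemma van_der_Waerden_3_2:
  fixes P :: "nat \<Rightarrow> bool"
  obtains i d where "d > 0" "P (i + d) = P i" "P (i + 2 * d) = P i"
proof -
  have "\<exists>i d. d > 0 \<and> P (i + d) = P i \<and> P (i + 2 * d) = P i"
  proof (rule ccontr)
    assume "\<not> ?thesis"
    then have *: "d > 0 \<Longrightarrow> \<not> (P (i + d) = P i \<and> P (i + 2 * d) = P i)" for i d
      by blast
    \<comment> \<open>Naming the three indices instead of start and difference lets numeral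
      instances be checked by plain arithmetic; the additive midpoint condition avoids truncated
      subtraction.\<close>
    have neq: "\<not> (P y = P x \<and> P z = P x)" if "x < y" "z + x = 2 * y" for x y z
    proof -
      have "x + (y - x) = y" "x + 2 * (y - x) = z"
        using that by simp_all
      then show ?thesis
        using *[of "y - x" x] that(1) by simp
    qed
    \<comment> \<open>All 16 three-term progressions within \<open>0..8\<close>, ordered by
      difference 1, 2, 3, 4. Together they are propositionally unsatisfiable.\<close>
    have
      "\<not> (P 1 = P 0 \<and> P 2 = P 0)" "\<not> (P 2 = P 1 \<and> P 3 = P 1)" "\<not> (P 3 = P 2 \<and> P 4 = P 2)"
      "\<not> (P 4 = P 3 \<and> P 5 = P 3)" "\<not> (P 5 = P 4 \<and> P 6 = P 4)" "\<not> (P 6 = P 5 \<and> P 7 = P 5)"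
      "\<not> (P 7 = P 6 \<and> P 8 = P 6)"
      "\<not> (P 2 = P 0 \<and> P 4 = P 0)" "\<not> (P 3 = P 1 \<and> P 5 = P 1)" "\<not> (P 4 = P 2 \<and> P 6 = P 2)"
      "\<not> (P 5 = P 3 \<and> P 7 = P 3)" "\<not> (P 6 = P 4 \<and> P 8 = P 4)"
      "\<not> (P 3 = P 0 \<and> P 6 = P 0)" "\<not> (P 4 = P 1 \<and> P 7 = P 1)" "\<not> (P 5 = P 2 \<and> P 8 = P 2)"
      "\<not> (P 4 = P 0 \<and> P 8 = P 0)"
      by (rule neq; simp)+
    then show False
      by satx
  qed
  then show thesis
    by (elim exE conjE) (rule that)
qed

text \<open>Each index is coloured by whether its term lies in \<open>A\<close>; a term outside
  \<open>A\<close> lies in \<open>B\<close> because the two sets cover the range.\<close>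

lemma equidistant_indices_in_part:
  fixes a :: "nat \<Rightarrow> 'a"
  assumes "range a \<subseteq> A \<union> B"
  obtains i d X where "X = A \<or> X = B" "d > 0" "a i \<in> X" "a (i + d) \<in> X" "a (i + 2 * d) \<in> X"
proof -
  obtain i d where d: "d > 0" "a (i + d) \<in> A \<longleftrightarrow> a i \<in> A" "a (i + 2 * d) \<in> A \<longleftrightarrow> a i \<in> A"
    by (rule van_der_Waerden_3_2[of "\<lambda>n. a n \<in> A"])
  have B: "a n \<in> B" if "a n \<notin> A" for n
    using assms that by blast
  show thesis
  proof (cases "a i \<in> A")
    case True
    with d show thesis
      by (intro that[of A d i]) simp_all
  next
    case False
    with d show thesis
      by (intro that[of B d i] B) simp_all
  qed
qed

text \<open>Ratio 0 would make the progression constant. For \<open>r \<noteq> 0\<close> a term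
  determines its index, since \<open>of_nat\<close> is injective in characteristic 0.\<close>

lemma arith_progression_inj:
  assumes "arith_progression a r" "nonconstant a"
  shows "inj a"
proof -
  have a: "a n = a 0 + of_nat n * r" for n
    using assms(1) unfolding arith_progression_def by blast
  have "r \<noteq> 0"
    using assms(2) a unfolding nonconstant_def by (metis mult_zero_right)
  then show ?thesis
    by (metis a add_left_cancel injI mult_right_cancel of_nat_eq_iff)
qed

lemma arith_progression_in_arith:
  assumes "arith_progression a r"
  shows "in_arith (a i) (a (i + d)) (a (i + 2 * d))"
proof -
  have a: "a n = a 0 + of_nat n * r" for n
    using assms unfolding arith_progression_def by blast
  show ?thesis
    unfolding in_arith_def a[of i] a[of "i + d"] a[of "i + 2 * d"] by (simp add: algebra_simps)
qed

text \<open>Both sides equal \<open>(a 0)^2 * r^(2 * i + 2 * d)\<close>. Nothing is divided, so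
  ratio 0 is covered.\<close>

lemma geom_progression_in_geom:
  assumes "geom_progression a r"
  shows "in_geom (a i) (a (i + d)) (a (i + 2 * d))"
proof -
  have a: "a n = a 0 * r ^ n" for n
    using assms unfolding geom_progression_def by blast
  show ?thesis
    unfolding in_geom_def a[of i] a[of "i + d"] a[of "i + 2 * d"]
    by (simp add: power_add power2_eq_square power_mult power_mult_distrib mult_ac)
qed

lemma geom_progression_inj:
  assumes "geom_progression a r" "infinite (range a)"
  shows "inj a"
proof (rule linorder_injI)
  fix m n :: nat
  assume "m < n"
  have a: "a k = a 0 * r ^ k" for k
    using assms(1) unfolding geom_progression_def by blast
  show "a m \<noteq> a n"
  proof
    assume "a m = a n"
    \<comment> \<open>Strong induction: from \<open>a m = a n\<close>, an index \<open>k > n\<close>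
      can be lowered by the period \<open>n - m\<close> to \<open>m + (k - n) < k\<close> without
      changing the term.\<close>
    have "a k \<in> a ` {..n}" for k
    proof (induction k rule: less_induct)
      case (less k)
      show ?case
      proof (cases "k \<le> n")
        case False
        then have "a k = a n * r ^ (k - n)"
          by (metis a linorder_le_cases mult.assoc power_add le_add_diff_inverse)
        also have "\<dots> = a (m + (k - n))"
          by (metis \<open>a m = a n\<close> a mult.assoc power_add)
        finally show ?thesis
          using less[of "m + (k - n)"] \<open>m < n\<close> False by simp
      qed auto
    qed
    then have "range a \<subseteq> a ` {..n}" by blast
    then show False
      using assms(2) finite_subset by blast
  qed
qed

theorem theorem2:
  fixes M A B :: "'a::field_char_0 set"
  assumes "A \<union> B = M" and "A \<inter> B = {}"
  shows "((\<exists>a r. arith_progression a r \<and> nonconstant a \<and> range a \<subseteq> M)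
            \<longrightarrow> contains_three_arith A \<or> contains_three_arith B)
       \<and> (\<forall>a r. geom_progression a r \<and> nonconstant a \<and> range a \<subseteq> M
            \<longrightarrow> (contains_three_geom_terms a A \<or> contains_three_geom_terms a B)
              \<and> (infinite (range a) \<longrightarrow> contains_three_geom A \<or> contains_three_geom B))"
proof (intro conjI impI allI)
  assume "\<exists>a r. arith_progression a r \<and> nonconstant a \<and> range a \<subseteq> M"
  then obtain a r where a: "arith_progression a r" "nonconstant a" "range a \<subseteq> A \<union> B"
    using assms(1) by blast
  obtain i d X where X: "X = A \<or> X = B" "d > 0" "a i \<in> X" "a (i + d) \<in> X" "a (i + 2 * d) \<in> X"
    using equidistant_indices_in_part[OF a(3)] .
  have "distinct [a i, a (i + d), a (i + 2 * d)]"
    using arith_progression_inj[OF a(1,2)] \<open>d > 0\<close> by (simp add: inj_eq)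
  then have "contains_three_arith X"
    unfolding contains_three_arith_def using X arith_progression_in_arith[OF a(1)] by blast
  then show "contains_three_arith A \<or> contains_three_arith B"
    using X(1) by blast
next
  fix a :: "nat \<Rightarrow> 'a" and r
  assume "geom_progression a r \<and> nonconstant a \<and> range a \<subseteq> M"
  then have a: "geom_progression a r" "range a \<subseteq> A \<union> B"
    using assms(1) by blast+
  obtain i d X where X: "X = A \<or> X = B" "d > 0" "a i \<in> X" "a (i + d) \<in> X" "a (i + 2 * d) \<in> X"
    using equidistant_indices_in_part[OF a(2)] .
  \<comment> \<open>Only the indices must differ here, so every ratio is treated alike.\<close>
  have "distinct [i, i + d, i + 2 * d]"
    using \<open>d > 0\<close> by simp
  then have "contains_three_geom_terms a X"
    unfolding contains_three_geom_terms_def using X geom_progression_in_geom[OF a(1)] by blast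
  then show "contains_three_geom_terms a A \<or> contains_three_geom_terms a B"
    using X(1) by blast
  \<comment> \<open>Assumed only now, as the preceding goal does not provide it. The same
    \<open>i\<close> and \<open>d\<close> serve again, with injectivity turning distinct indices
    into distinct terms.\<close>
  assume "infinite (range a)"
  then have "distinct [a i, a (i + d), a (i + 2 * d)]"
    using geom_progression_inj[OF a(1)] \<open>d > 0\<close> by (simp add: inj_eq)
  then have "contains_three_geom X"
    unfolding contains_three_geom_def using X geom_progression_in_geom[OF a(1)] by blast
  then show "contains_three_geom A \<or> contains_three_geom B"
    using X(1) by blast
qed

end
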